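(* Let $q\ge 1$ and $n\ge q+5$ be integers. Then (1) $\mathrm{sat}(n, K_1\vee(2K_{2}\cup qK_1))=n+2$; (2) $\mathrm{SAT}(n, K_1\vee(2K_{2}\cup qK_1))=\{K_4^{+(n-4)}\}$ up to isomorphism.
   Context: All graphs are finite and simple. For graphs $F$ and $G$, $G$ is $F$-saturated if $G$ contains no copy of $F$ as a (not necessarily induced) subgraph, but for every edge $e$ of the complement $\overline{G}$, the graph $G+e$ obtained by adding $e$ to $G$ contains a copy of $F$. The saturation number $\mathrm{sat}(n,F)$ is the minimum number of edges in an $F$-saturated graph on $n$ vertices, and $\mathrm{SAT}(n,F)$ is the set (up to isomorphism) of $F$-saturated graphs on $n$ vertices with exactly $\mathrm{sat}(n,F)$ edges. $K_m$ is the complete graph on $m$ vertices, $\cup$ denotes vertex-disjoint union, $mG$ denotes the disjoint union of $m$ copies of $G$, and $G_1\vee G_2$ is the join, obtained from the disjoint union $G_1\cup G_2$ by adding all edges between $V(G_1)$ and $V(G_2)$. $K_s^{+t}$ denotes the graph obtained from the complete graph $K_s$ by attaching $t$ leaves (new vertices of degree one) to one and the same vertex of $K_s$. *)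

theory Defs
  imports Main
begin

datatype 'a graph = Graph (verts: "'a set") (edges: "'a set set")

definition pairs :: "'a set \<Rightarrow> 'a set set" where
  "pairs V = {e. e \<subseteq> V \<and> card e = 2}"

definition simple_graph :: "'a graph \<Rightarrow> bool" where
  "simple_graph G \<longleftrightarrow> finite (verts G) \<and> edges G \<subseteq> pairs (verts G)"

definition complement :: "'a graph \<Rightarrow> 'a graph" where
  "complement G = Graph (verts G) (pairs (verts G) - edges G)"

definition add_edge :: "'a graph \<Rightarrow> 'a set \<Rightarrow> 'a graph" where
  "add_edge G e = Graph (verts G) (insert e (edges G))"

definition contains_copy :: "'b graph \<Rightarrow> 'a graph \<Rightarrow> bool" where
  "contains_copy G F \<longleftrightarrow>
     (\<exists>f. inj_on f (verts F) \<and> f ` verts F \<subseteq> verts G \<and> (\<forall>e\<in>edges F. f ` e \<in> edges G))"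

definition isomorphic :: "'a graph \<Rightarrow> 'b graph \<Rightarrow> bool" where
  "isomorphic G H \<longleftrightarrow>
     (\<exists>f. bij_betw f (verts G) (verts H) \<and> edges H = (\<lambda>e. f ` e) ` edges G)"

definition complete :: "nat \<Rightarrow> nat graph" where
  "complete m = Graph {..<m} (pairs {..<m})"

definition disj_union :: "'a graph \<Rightarrow> 'b graph \<Rightarrow> ('a + 'b) graph" where
  "disj_union G H =
     Graph (verts G <+> verts H)
           ((\<lambda>e. Inl ` e) ` edges G \<union> (\<lambda>e. Inr ` e) ` edges H)"

definition copies :: "nat \<Rightarrow> 'a graph \<Rightarrow> (nat \<times> 'a) graph" where
  "copies m G =
     Graph ({..<m} \<times> verts G) {Pair i ` e | i e. i < m \<and> e \<in> edges G}"

definition join :: "'a graph \<Rightarrow> 'b graph \<Rightarrow> ('a + 'b) graph" where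
  "join G H =
     Graph (verts G <+> verts H)
           (edges (disj_union G H) \<union> {{Inl u, Inr v} | u v. u \<in> verts G \<and> v \<in> verts H})"

text \<open>The graph \<open>K\<^sub>s\<^sup>+\<^sup>t\<close>, meaningful for \<open>s \<ge> 1\<close>: the \<open>t\<close> leaves are the vertices
  \<open>s, \<dots>, s + t - 1\<close>, all attached to the vertex \<open>0\<close> of \<open>K\<^sub>s\<close>.\<close>

definition complete_leaves :: "nat \<Rightarrow> nat \<Rightarrow> nat graph" where
  "complete_leaves s t =
     Graph {..<s + t} (edges (complete s) \<union> {{0, i} | i. s \<le> i \<and> i < s + t})"

definition saturated :: "'a graph \<Rightarrow> 'b graph \<Rightarrow> bool" where
  "saturated F G \<longleftrightarrow>
     simple_graph G \<and> \<not> contains_copy G F \<and>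
     (\<forall>e\<in>edges (complement G). contains_copy (add_edge G e) F)"

text \<open>Every finite graph is isomorphic to one whose vertices are natural numbers, so graphs
  on \<open>n\<close> vertices are taken with vertex set any \<open>n\<close>-element set of naturals.\<close>

definition saturated_graphs :: "nat \<Rightarrow> 'a graph \<Rightarrow> nat graph set" where
  "saturated_graphs n F = {G. saturated F G \<and> card (verts G) = n}"

definition sat :: "nat \<Rightarrow> 'a graph \<Rightarrow> nat" where
  "sat n F = (LEAST m. \<exists>G\<in>saturated_graphs n F. card (edges G) = m)"

definition iso_class :: "nat graph \<Rightarrow> nat graph set" where
  "iso_class G = {H. simple_graph H \<and> isomorphic G H}"

text \<open>A set of graphs up to isomorphism is represented by the set of their isomorphism classes.\<close>

definition SAT :: "nat \<Rightarrow> 'a graph \<Rightarrow> nat graph set set" where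
  "SAT n F = iso_class ` {G \<in> saturated_graphs n F. card (edges G) = sat n F}"

end

theory Submission
  imports Defs
begin

text \<open>A graph contains the windmill iff some vertex of degree at least \<open>q + 4\<close> is the centre of a
  bowtie, i.e. has two disjoint edges in its neighbourhood. Hence in a saturated graph two
  nonadjacent vertices, one of degree at most 3, either have a common neighbour of degree at
  least 5 or the other one has degree at least 4. If some vertex \<open>z\<close> is adjacent to all others,
  the edges avoiding \<open>z\<close> meet pairwise: they form a triangle, which gives the extremal graph, or a
  star, which saturation forces to be spanning, giving \<open>2n - 3\<close> edges. If no such vertex exists,
  at least \<open>n + 3\<close> edges are found by weighing degrees, according to the minimum degree.\<close>

section \<open>Neighbourhoods and degrees\<close>

definition nbrs :: "'a graph \<Rightarrow> 'a \<Rightarrow> 'a set" where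
  "nbrs G v = {u. {v, u} \<in> edges G}"

abbreviation degree :: "'a graph \<Rightarrow> 'a \<Rightarrow> nat" where
  "degree G v \<equiv> card (nbrs G v)"

lemma mem_nbrs: "u \<in> nbrs G v \<longleftrightarrow> {v, u} \<in> edges G"
  by (simp add: nbrs_def)

lemma nbrs_sym: "u \<in> nbrs G v \<longleftrightarrow> v \<in> nbrs G u"
  by (simp add: nbrs_def insert_commute)

lemma pair_mem_pairs: "{u, v} \<in> pairs V \<longleftrightarrow> u \<in> V \<and> v \<in> V \<and> u \<noteq> v"
  by (auto simp: pairs_def card_2_iff doubleton_eq_iff)

lemma edge_pairD:
  assumes "simple_graph G" "{u, v} \<in> edges G"
  shows "u \<in> verts G" "v \<in> verts G" "u \<noteq> v"
  using assms pair_mem_pairs[of u v "verts G"] by (auto simp: simple_graph_def)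

lemma edgeE:
  assumes "simple_graph G" "e \<in> edges G"
  obtains u v where "e = {u, v}" "u \<noteq> v" "u \<in> verts G" "v \<in> verts G"
  using assms by (auto simp: simple_graph_def pairs_def card_2_iff)

lemma nbrs_subset: "simple_graph G \<Longrightarrow> nbrs G v \<subseteq> verts G - {v}"
  unfolding nbrs_def using edge_pairD[of G v] by blast

lemma finite_nbrs: "simple_graph G \<Longrightarrow> finite (nbrs G v)"
  by (rule finite_subset[OF nbrs_subset]) (simp_all add: simple_graph_def)

lemma finite_edges: "simple_graph G \<Longrightarrow> finite (edges G)"
  by (rule finite_subset[of _ "Pow (verts G)"]) (auto simp: simple_graph_def pairs_def)

text \<open>Counting incident edges instead of neighbours prepares the double counting in
  \<open>handshake\<close>.\<close>

lemma degree_eq_card_incident: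
  assumes "simple_graph G"
  shows "degree G v = card {e \<in> edges G. v \<in> e}"
proof (rule bij_betw_same_card[of "\<lambda>u. {v, u}"])
  show "bij_betw (\<lambda>u. {v, u}) (nbrs G v) {e \<in> edges G. v \<in> e}"
    unfolding bij_betw_def
  proof
    show "inj_on (\<lambda>u. {v, u}) (nbrs G v)"
      by (auto simp: inj_on_def doubleton_eq_iff)
    show "(\<lambda>u. {v, u}) ` nbrs G v = {e \<in> edges G. v \<in> e}"
    proof (intro equalityI subsetI)
      fix e assume e: "e \<in> {e \<in> edges G. v \<in> e}"
      then obtain a b where "e = {a, b}" using assms edgeE by blast
      with e show "e \<in> (\<lambda>u. {v, u}) ` nbrs G v"
        by (auto simp: nbrs_def insert_commute)
    qed (auto simp: nbrs_def)
  qed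
qed

lemma handshake:
  assumes "simple_graph G"
  shows "(\<Sum>v\<in>verts G. degree G v) = 2 * card (edges G)"
proof -
  have fin: "finite (verts G)" "finite (edges G)"
    using assms finite_edges by (auto simp: simple_graph_def)
  have "card {v \<in> verts G. v \<in> e} = 2" if "e \<in> edges G" for e
  proof -
    have "{v \<in> verts G. v \<in> e} = e" "card e = 2"
      using that assms by (auto simp: simple_graph_def pairs_def)
    then show ?thesis by simp
  qed
  then have "(\<Sum>v\<in>verts G. card {e \<in> edges G. v \<in> e}) = 2 * card (edges G)"
    by (intro sum_multicount fin) auto
  then show ?thesis using assms by (simp add: degree_eq_card_incident)
qed

text \<open>Spreading the degree of \<open>z\<close> over its neighbours makes a leaf at \<open>z\<close> weigh 2, like any other
  vertex outside a few heavy ones.\<close>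

lemma handshake_remove:
  assumes "simple_graph G" "z \<in> verts G"
  shows "(\<Sum>v\<in>verts G - {z}. degree G v + (if v \<in> nbrs G z then 1 else 0)) = 2 * card (edges G)"
proof -
  have fin: "finite (verts G)" using assms by (simp add: simple_graph_def)
  have "(\<Sum>v\<in>verts G - {z}. if v \<in> nbrs G z then 1 else (0::nat)) = card ((verts G - {z}) \<inter> nbrs G z)"
    using fin by (simp add: sum.If_cases Int_def)
  also have "(verts G - {z}) \<inter> nbrs G z = nbrs G z"
    using nbrs_subset[OF assms(1)] by blast
  finally show ?thesis
    using handshake[OF assms(1)] sum.remove[OF fin assms(2), of "degree G"]
    by (simp add: sum.distrib)
qed

text \<open>The weighing scheme of all later bounds: every element weighs at least \<open>a\<close>,
  and the heavy elements in \<open>T\<close> carry an excess \<open>b\<close> that is summed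
  separately.\<close>

lemma sum_ge_const_subset:
  fixes f :: "'a \<Rightarrow> nat"
  assumes "finite V" "T \<subseteq> V" "\<And>v. v \<in> V \<Longrightarrow> f v \<ge> a" "\<And>v. v \<in> T \<Longrightarrow> f v \<ge> a + b v"
  shows "(\<Sum>v\<in>V. f v) \<ge> a * card V + (\<Sum>v\<in>T. b v)"
proof -
  have "(\<Sum>v\<in>T. b v) = (\<Sum>v\<in>V. if v \<in> T then b v else 0)"
    using assms(1,2) by (simp add: sum.If_cases Int_absorb1)
  then have "a * card V + (\<Sum>v\<in>T. b v) = (\<Sum>v\<in>V. a + (if v \<in> T then b v else 0))"
    by (simp add: sum.distrib)
  also have "\<dots> \<le> (\<Sum>v\<in>V. f v)"
    by (rule sum_mono) (use assms(3,4) in auto)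
  finally show ?thesis .
qed

section \<open>Isomorphism\<close>

text \<open>Equality of edge sets becomes a test on pairs of vertices, since every edge on either
  side is a pair and \<open>f\<close> reaches all vertices of \<open>H\<close>.\<close>

lemma isomorphicI:
  assumes "simple_graph G" "simple_graph H" and bij: "bij_betw f (verts G) (verts H)"
    and eq: "\<And>u v. u \<in> verts G \<Longrightarrow> v \<in> verts G \<Longrightarrow> {f u, f v} \<in> edges H \<longleftrightarrow> {u, v} \<in> edges G"
  shows "isomorphic G H"
  unfolding isomorphic_def
proof (intro exI conjI)
  show "edges H = (\<lambda>e. f ` e) ` edges G"
  proof (intro equalityI subsetI)
    fix e assume e: "e \<in> edges H"
    then obtain a b where ab: "e = {a, b}" "a \<in> verts H" "b \<in> verts H"
      using edgeE[OF assms(2)] by metis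
    then obtain u v where "u \<in> verts G" "v \<in> verts G" "a = f u" "b = f v"
      using bij by (metis bij_betw_imp_surj_on imageE)
    with ab e eq show "e \<in> (\<lambda>e. f ` e) ` edges G"
      by (intro image_eqI[of _ _ "{u, v}"]) auto
  next
    fix e assume "e \<in> (\<lambda>e. f ` e) ` edges G"
    then obtain e' where e': "e = f ` e'" "e' \<in> edges G" by blast
    then obtain u v where "e' = {u, v}" "u \<in> verts G" "v \<in> verts G"
      using edgeE[OF assms(1)] by metis
    with e' eq show "e \<in> edges H" by auto
  qed
qed (rule bij)

lemma isomorphic_sym:
  assumes "simple_graph G" "isomorphic G H"
  shows "isomorphic H G"
proof -
  obtain f where f: "bij_betw f (verts G) (verts H)" "edges H = (\<lambda>e. f ` e) ` edges G"
    using assms(2) by (auto simp: isomorphic_def)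
  let ?g = "inv_into (verts G) f"
  have "?g ` f ` e = e" if "e \<in> edges G" for e
  proof -
    have "e \<subseteq> verts G" using that assms(1) by (auto simp: simple_graph_def pairs_def)
    then show ?thesis using f(1) by (simp add: bij_betw_def)
  qed
  then have "edges G = (\<lambda>e. ?g ` e) ` edges H"
    unfolding f(2) image_image by simp
  then show ?thesis using bij_betw_inv_into[OF f(1)] by (auto simp: isomorphic_def)
qed

lemma isomorphic_trans:
  assumes "isomorphic G H" "isomorphic H K"
  shows "isomorphic G K"
proof -
  obtain f g where "bij_betw f (verts G) (verts H)" "edges H = (\<lambda>e. f ` e) ` edges G"
    "bij_betw g (verts H) (verts K)" "edges K = (\<lambda>e. g ` e) ` edges H"
    using assms by (auto simp: isomorphic_def)
  then show ?thesis
    unfolding isomorphic_def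
    by (intro exI[of _ "g \<circ> f"]) (auto simp: bij_betw_trans image_comp)
qed

text \<open>\<open>SAT\<close> collects isomorphism classes, so uniqueness up to isomorphism is an
  equality of classes; it follows from symmetry and transitivity.\<close>

lemma iso_class_eq:
  assumes "simple_graph G" "simple_graph H" "isomorphic G H"
  shows "iso_class G = iso_class H"
proof -
  have "isomorphic G K \<longleftrightarrow> isomorphic H K" for K :: "nat graph"
    using isomorphic_trans[OF assms(3), of K] isomorphic_trans[OF isomorphic_sym[OF assms(1,3)], of K]
    by blast
  then show ?thesis by (simp add: iso_class_def)
qed

section \<open>Copies of the forbidden graph\<close>

text \<open>The forbidden graph: two triangles sharing the hub \<open>Inl 0\<close>, with
  \<open>q\<close> leaves at the hub.\<close>

definition windmill :: "nat \<Rightarrow> (nat + (nat \<times> nat) + (nat \<times> nat)) graph" where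
  "windmill q = join (complete 1) (disj_union (copies 2 (complete 2)) (copies q (complete 1)))"

text \<open>The windmill without its leaves: two triangles that meet only in the centre
  \<open>c\<close>.\<close>

definition bowtie :: "'a graph \<Rightarrow> 'a \<Rightarrow> 'a \<Rightarrow> 'a \<Rightarrow> 'a \<Rightarrow> 'a \<Rightarrow> bool" where
  "bowtie G c p q r s \<longleftrightarrow> distinct [c, p, q, r, s] \<and>
     {{c, p}, {c, q}, {c, r}, {c, s}, {p, q}, {r, s}} \<subseteq> edges G"

lemma verts_windmill:
  "verts (windmill k) = insert (Inl 0) (Inr ` (Inl ` {(0,0),(0,1),(1,0),(1,1)} \<union> Inr ` ({..<k} \<times> {0})))"
  by (auto simp: windmill_def join_def disj_union_def copies_def complete_def less_2_cases_iff)

lemma pairs_lessThan_1: "pairs {..<Suc 0} = {}"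
  by (auto simp: pairs_def card_2_iff)

lemma pairs_lessThan_2: "pairs {..<2::nat} = {{0, 1}}"
  by (auto simp: pairs_def card_2_iff doubleton_eq_iff less_2_cases_iff)

lemma edges_windmill:
  "edges (windmill k) =
     (\<lambda>v. {Inl 0, v}) ` (verts (windmill k) - {Inl 0}) \<union>
     {{Inr (Inl (0, 0)), Inr (Inl (0, 1))}, {Inr (Inl (1, 0)), Inr (Inl (1, 1))}}"
proof -
  have c2: "edges (copies 2 (complete 2)) = {{(0, 0), (0, 1)}, {(1, 0), (1, 1)}}"
    by (auto simp: copies_def complete_def pairs_lessThan_2 less_2_cases_iff)
  have c1: "edges (copies k (complete 1)) = {}"
    by (auto simp: copies_def complete_def pairs_lessThan_1)
  have e: "edges (windmill k) = (\<lambda>e. Inr ` e) ` (\<lambda>e. Inl ` e) ` edges (copies 2 (complete 2)) \<union>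
     {{Inl u, Inr v} | u v. u \<in> {0} \<and> v \<in> verts (disj_union (copies 2 (complete 2)) (copies k (complete 1)))}"
    using c1 by (auto simp: windmill_def join_def disj_union_def complete_def pairs_lessThan_1)
  have v: "verts (windmill k) - {Inl 0} = Inr ` verts (disj_union (copies 2 (complete 2)) (copies k (complete 1)))"
    by (auto simp: windmill_def join_def complete_def)
  show ?thesis unfolding e v c2 by auto
qed

text \<open>The leaves of the windmill have no edges except to the hub, so any \<open>k\<close>
  further neighbours of a bowtie centre can play them; only the degree of the centre
  matters.\<close>

lemma contains_windmill_iff:
  assumes G: "simple_graph G"
  shows "contains_copy G (windmill k) \<longleftrightarrow> (\<exists>c p q r s. bowtie G c p q r s \<and> degree G c \<ge> k + 4)"
proof
  assume "contains_copy G (windmill k)"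
  then obtain f where f: "inj_on f (verts (windmill k))"
    "\<And>e. e \<in> edges (windmill k) \<Longrightarrow> f ` e \<in> edges G"
    by (auto simp: contains_copy_def)
  let ?c = "f (Inl 0)" and ?p = "f (Inr (Inl (0, 0)))" and ?q = "f (Inr (Inl (0, 1)))"
    and ?r = "f (Inr (Inl (1, 0)))" and ?s = "f (Inr (Inl (1, 1)))"
  let ?W = "verts (windmill k) - {Inl 0}"
  have adj: "{?c, f v} \<in> edges G" if "v \<in> ?W" for v
    using f(2)[of "{Inl 0, v}"] that by (simp add: edges_windmill)
  have pq: "{?p, ?q} \<in> edges G" "{?r, ?s} \<in> edges G"
    using f(2)[of "{Inr (Inl (0, 0)), Inr (Inl (0, 1))}"] f(2)[of "{Inr (Inl (1, 0)), Inr (Inl (1, 1))}"]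
    by (simp_all add: edges_windmill)
  have "distinct [?c, ?p, ?q, ?r, ?s]"
    using f(1) by (auto simp: inj_on_eq_iff[OF f(1)] verts_windmill)
  then have "bowtie G ?c ?p ?q ?r ?s"
    using pq adj by (simp add: bowtie_def verts_windmill)
  \<comment> \<open>The \<open>4 + k\<close> vertices other than the hub are sent injectively to
    neighbours of its image.\<close>
  moreover have "k + 4 \<le> degree G ?c"
  proof -
    let ?A = "Inl ` {(0::nat, 0::nat), (0, 1), (1, 0), (1, 1)} :: ((nat \<times> nat) + (nat \<times> nat)) set"
      and ?B = "Inr ` ({..<k} \<times> {0::nat}) :: ((nat \<times> nat) + (nat \<times> nat)) set"
    have "?W = Inr ` (?A \<union> ?B)"
      unfolding verts_windmill by blast
    then have "card ?W = card (?A \<union> ?B)"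
      by (simp only: card_image inj_Inr)
    also have "\<dots> = card ?A + card ?B"
      by (rule card_Un_disjoint) auto
    also have "card ?B = k"
      by (simp add: card_image card_cartesian_product)
    finally have "card ?W = 4 + k" by simp
    moreover have "card ?W = card (f ` ?W)"
      by (rule card_image[symmetric]) (rule inj_on_subset[OF f(1)], auto)
    moreover have "card (f ` ?W) \<le> degree G ?c"
      by (rule card_mono[OF finite_nbrs[OF G]]) (use adj in \<open>unfold nbrs_def, blast\<close>)
    ultimately show ?thesis by simp
  qed
  ultimately show "\<exists>c p q r s. bowtie G c p q r s \<and> degree G c \<ge> k + 4" by blast
next
  assume "\<exists>c p q r s. bowtie G c p q r s \<and> degree G c \<ge> k + 4"
  then obtain c p q r s where b: "bowtie G c p q r s" and d: "degree G c \<ge> k + 4" by blast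
  let ?R = "nbrs G c - {p, q, r, s}"
  have c: "c \<notin> nbrs G c" using nbrs_subset[OF G] by blast
  \<comment> \<open>The triangles use up at most four neighbours of \<open>c\<close>, leaving room
    for \<open>k\<close> leaves.\<close>
  have "card {..<k} \<le> card ?R"
    using d diff_card_le_card_Diff[of "{p, q, r, s}" "nbrs G c"] card_length[of "[p, q, r, s]"] by simp
  then obtain g where g: "g ` {..<k} \<subseteq> ?R" "inj_on g {..<k}"
    using card_le_inj[of "{..<k}" ?R] finite_nbrs[OF G] by auto
  define f where "f = case_sum (\<lambda>_::nat. c)
    (case_sum (\<lambda>(i, j). if i = (0::nat) then if j = (0::nat) then p else q else if j = 0 then r else s)
      (\<lambda>(i, _::nat). g i))"
  have inj: "inj_on f (verts (windmill k))"
    unfolding inj_on_def verts_windmill using g b c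
    by (auto simp: f_def bowtie_def inj_on_def)
  have adj: "{c, f v} \<in> edges G" if "v \<in> verts (windmill k) - {Inl 0}" for v
    using that g b by (auto simp: f_def verts_windmill bowtie_def mem_nbrs)
  have e: "\<forall>e\<in>edges (windmill k). f ` e \<in> edges G"
  proof
    fix e assume "e \<in> edges (windmill k)"
    then consider v where "v \<in> verts (windmill k) - {Inl 0}" "e = {Inl 0, v}"
      | "e = {Inr (Inl (0, 0)), Inr (Inl (0, 1))}" | "e = {Inr (Inl (1, 0)), Inr (Inl (1, 1))}"
      unfolding edges_windmill by blast
    then show "f ` e \<in> edges G"
    proof cases
      case 1
      have "f (Inl 0) = c" by (simp add: f_def)
      with 1 adj show ?thesis by simp
    qed (use b in \<open>auto simp: f_def bowtie_def\<close>)
  qed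
  have "f v \<in> verts G" if "v \<in> verts (windmill k)" for v
  proof (cases "v = Inl 0")
    case True
    then show ?thesis using b edge_pairD(1)[OF G, of c p] by (simp add: f_def bowtie_def)
  next
    case False
    then show ?thesis using adj that edge_pairD(2)[OF G] by blast
  qed
  with inj e show "contains_copy G (windmill k)"
    unfolding contains_copy_def by blast
qed

section \<open>Consequences of saturation\<close>

lemma edges_add_edge: "edges (add_edge G e) = insert e (edges G)"
  by (simp add: add_edge_def)

lemma simple_add_edge:
  assumes "simple_graph G" "x \<in> verts G" "y \<in> verts G" "x \<noteq> y"
  shows "simple_graph (add_edge G {x, y})"
  using assms pair_mem_pairs[of x y "verts G"] by (auto simp: simple_graph_def add_edge_def)

lemma nbrs_add_edge:
  "nbrs (add_edge G {x, y}) v =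
     nbrs G v \<union> (if v = x then {y} else {}) \<union> (if v = y then {x} else {})"
  by (auto simp: nbrs_def add_edge_def doubleton_eq_iff)

lemma degree_add_edge_le:
  assumes "simple_graph G"
  shows "degree (add_edge G {x, y}) v \<le> Suc (degree G v)"
proof -
  \<comment> \<open>The inserted vertex is the new neighbour when \<open>v\<close> is an end of the
    edge; for any other \<open>v\<close> it only enlarges the bound.\<close>
  have "nbrs (add_edge G {x, y}) v \<subseteq> insert (if v = x then y else x) (nbrs G v)"
    by (auto simp: nbrs_add_edge)
  then have "degree (add_edge G {x, y}) v \<le> card (insert (if v = x then y else x) (nbrs G v))"
    by (rule card_mono[rotated]) (simp add: finite_nbrs assms)
  also have "\<dots> \<le> Suc (degree G v)"
    by (simp add: card_insert_if finite_nbrs assms)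
  finally show ?thesis .
qed

section \<open>Bowties, their vertex covers, and intersecting families of pairs\<close>

lemma bowtieD:
  assumes "bowtie G c p q r s"
  shows "{p, q, r, s} \<subseteq> nbrs G c" "q \<in> nbrs G p" "p \<in> nbrs G q" "s \<in> nbrs G r" "r \<in> nbrs G s"
  using assms by (simp_all add: bowtie_def nbrs_def insert_commute)

lemma bowtie_degree:
  assumes "simple_graph G" "bowtie G c p q r s"
  shows "degree G c \<ge> 4"
proof -
  have "card {p, q, r, s} = 4" using assms(2) by (simp add: bowtie_def)
  then show ?thesis
    using card_mono[OF finite_nbrs[OF assms(1)] bowtieD(1)[OF assms(2)]] by simp
qed

lemma bowtie_del_edge:
  assumes b: "bowtie (add_edge G e) c p q r s" and e: "\<not> e \<subseteq> {c, p, q, r, s}"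
  shows "bowtie G c p q r s"
proof -
  have "f \<in> edges G" if "f \<in> {{c, p}, {c, q}, {c, r}, {c, s}, {p, q}, {r, s}}" for f
  proof -
    have "f \<subseteq> {c, p, q, r, s}" using that by blast
    moreover have "f \<in> insert e (edges G)"
      using that b unfolding bowtie_def edges_add_edge by blast
    ultimately show ?thesis using e by blast
  qed
  then show ?thesis using b unfolding bowtie_def by blast
qed

text \<open>A vertex cover of a bowtie has at least three vertices: one from each of
  \<open>{p, q}\<close> and \<open>{r, s}\<close>, and in addition \<open>c\<close>, unless it
  contains all neighbours of \<open>c\<close>.\<close>

lemma bowtie_no_cover:
  assumes "bowtie G c p q r s" "\<And>e. e \<in> edges G \<Longrightarrow> z \<in> e \<or> w \<in> e"
  shows False
proof -
  have two: "\<lbrakk>a \<in> {z, w}; b \<in> {z, w}; d \<in> {z, w}; a \<noteq> b; b \<noteq> d; a \<noteq> d\<rbrakk> \<Longrightarrow> False" for a b d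
    by blast
  have cover: "a \<in> {z, w} \<or> b \<in> {z, w}" if "{a, b} \<in> edges G" for a b
    using assms(2)[OF that] by blast
  have pqrs: "p \<in> {z, w} \<or> q \<in> {z, w}" "r \<in> {z, w} \<or> s \<in> {z, w}"
    using assms(1) by (intro cover; simp add: bowtie_def)+
  have c: "c \<in> {z, w} \<or> (p \<in> {z, w} \<and> q \<in> {z, w} \<and> r \<in> {z, w})"
    using cover[of c p] cover[of c q] cover[of c r] assms(1) unfolding bowtie_def by blast
  have "c \<noteq> p" "c \<noteq> q" "c \<noteq> r" "c \<noteq> s" "p \<noteq> q" "p \<noteq> r" "p \<noteq> s" "q \<noteq> r" "q \<noteq> s"
    using assms(1) by (simp_all add: bowtie_def)
  with pqrs c two show False by metis
qed

text \<open>If no point is common, take a member \<open>{a, b}\<close>, one avoiding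
  \<open>a\<close> and one avoiding \<open>b\<close>. They are \<open>{b, c}\<close> and
  \<open>{a, c}\<close> with the same \<open>c\<close> because they meet, and any pair meeting all
  three sides is one of them. The empty family falls under the first alternative.\<close>

lemma pairwise_intersecting_pairs:
  assumes two: "\<And>e. e \<in> H \<Longrightarrow> card e = 2"
    and meet: "\<And>e f. e \<in> H \<Longrightarrow> f \<in> H \<Longrightarrow> e \<inter> f \<noteq> {}"
  shows "(\<exists>w. \<forall>e\<in>H. w \<in> e) \<or>
    (\<exists>a b c. distinct [a, b, c] \<and> H = {{a, b}, {b, c}, {a, c}})"
proof (cases "\<exists>w. \<forall>e\<in>H. w \<in> e")
  case False
  then obtain e where e: "e \<in> H" by blast
  then obtain a b where ab: "e = {a, b}" "a \<noteq> b" using two[OF e] by (auto simp: card_2_iff)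
  obtain f where f: "f \<in> H" "a \<notin> f" using False by blast
  obtain g where g: "g \<in> H" "b \<notin> g" using False by blast
  have "b \<in> f" using meet[OF e f(1)] f(2) ab by blast
  then obtain c where c: "f = {b, c}" "b \<noteq> c"
    using two[OF f(1)] by (auto simp: card_2_iff)
  have "a \<in> g" using meet[OF e g(1)] g(2) ab by blast
  then obtain d where d: "g = {a, d}" "a \<noteq> d"
    using two[OF g(1)] by (auto simp: card_2_iff)
  have "d = c" using meet[OF f(1) g(1)] c d f(2) g(2) by blast
  have "h \<in> {{a, b}, {b, c}, {a, c}}" if h: "h \<in> H" for h
  proof -
    obtain i j where ij: "h = {i, j}" using two[OF h] by (auto simp: card_2_iff)
    have "h \<inter> {a, b} \<noteq> {}" "h \<inter> {b, c} \<noteq> {}" "h \<inter> {a, c} \<noteq> {}"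
      using meet[OF h e] meet[OF h f(1)] meet[OF h g(1)] ab c d \<open>d = c\<close> by simp_all
    then show ?thesis using ij ab(2) c(2) d(2) \<open>d = c\<close> by auto
  qed
  then have "H = {{a, b}, {b, c}, {a, c}}"
    using e f(1) g(1) ab c d \<open>d = c\<close> by blast
  moreover have "distinct [a, b, c]" using ab c d \<open>d = c\<close> by simp
  ultimately show ?thesis by blast
qed blast

section \<open>Missing edges of a saturated graph, and the case of a universal vertex\<close>

locale windmill_saturated =
  fixes G :: "'a graph" and k :: nat
  assumes sat: "saturated (windmill k) G" and k: "k \<ge> 1"
    and large: "card (verts G) \<ge> k + 5"
begin

lemma simple: "simple_graph G"
  using sat by (simp add: saturated_def)

lemma finV: "finite (verts G)"
  using simple by (simp add: simple_graph_def)

lemma no_bowtie: "bowtie G c p q r s \<Longrightarrow> degree G c < k + 4"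
  unfolding not_le[symmetric] using sat contains_windmill_iff[OF simple, of k] unfolding saturated_def by blast

lemma nonedge_bowtie:
  assumes "x \<in> verts G" "y \<in> verts G" "x \<noteq> y" "y \<notin> nbrs G x"
  obtains c p q r s where "bowtie (add_edge G {x, y}) c p q r s"
    "degree (add_edge G {x, y}) c \<ge> k + 4"
proof -
  have "{x, y} \<in> edges (complement G)"
    using assms by (simp add: complement_def pair_mem_pairs mem_nbrs)
  then have "contains_copy (add_edge G {x, y}) (windmill k)"
    using sat by (simp add: saturated_def)
  then show thesis
    using that by (auto simp: contains_windmill_iff simple_add_edge simple assms)
qed

text \<open>Adding \<open>{x, y}\<close> creates a windmill with hub \<open>c\<close>, which is too
  large in degree to be \<open>x\<close>. If \<open>c\<close> is not \<open>y\<close>, its degree is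
  unchanged, so its bowtie must use the new edge, and both \<open>x\<close> and \<open>y\<close> are
  neighbours of \<open>c\<close>.\<close>

lemma common_nbr_or_degree:
  assumes xy: "x \<in> verts G" "y \<in> verts G" "x \<noteq> y" "y \<notin> nbrs G x" and "degree G x \<le> 3"
  shows "degree G y \<ge> 4 \<or> (\<exists>c. c \<in> nbrs G x \<and> c \<in> nbrs G y \<and> degree G c \<ge> 5)"
proof -
  let ?H = "add_edge G {x, y}"
  obtain c p q r s where b: "bowtie ?H c p q r s" and d: "degree ?H c \<ge> k + 4"
    by (rule nonedge_bowtie[OF xy])
  \<comment> \<open>The new edge raises the degree by at most one, and \<open>k + 4\<close> is at
    least 5.\<close>
  have d4: "degree G c \<ge> 4"
    using le_trans[OF d degree_add_edge_le[OF simple]] k by linarith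
  have "c \<noteq> x"
  proof
    assume "c = x"
    with d4 assms(5) show False by simp
  qed
  show ?thesis
  proof (cases "c = y")
    case True
    then show ?thesis using d4 by simp
  next
    case False
    with \<open>c \<noteq> x\<close> have N: "nbrs ?H c = nbrs G c" by (simp add: nbrs_add_edge)
    have "x \<in> nbrs G c \<and> y \<in> nbrs G c"
    proof (rule ccontr)
      assume "\<not> ?thesis"
      then have "\<not> {x, y} \<subseteq> {c, p, q, r, s}"
        using bowtieD(1)[OF b] N \<open>c \<noteq> x\<close> False by blast
      then have "bowtie G c p q r s" by (rule bowtie_del_edge[OF b])
      then show False using no_bowtie[of c p q r s] d N by simp
    qed
    moreover have "degree G c \<ge> 5" using d k unfolding N by linarith
    ultimately show ?thesis using nbrs_sym[of c] by blast
  qed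
qed

text \<open>Without a common neighbour the hub of the new windmill can only be \<open>y\<close>. A
  triangle through the new edge would need a common neighbour as well, so the bowtie at
  \<open>y\<close> avoids \<open>x\<close> and is already present in \<open>G\<close>.\<close>

lemma bowtie_if_no_common_nbr:
  assumes xy: "x \<in> verts G" "y \<in> verts G" "x \<noteq> y" "y \<notin> nbrs G x" and "degree G x \<le> 3"
    and no: "nbrs G x \<inter> nbrs G y = {}"
  shows "\<exists>p q r s. bowtie G y p q r s"
proof -
  let ?H = "add_edge G {x, y}"
  obtain c p q r s where b: "bowtie ?H c p q r s" and d: "degree ?H c \<ge> k + 4"
    by (rule nonedge_bowtie[OF xy])
  have d4: "degree G c \<ge> 4"
    using le_trans[OF d degree_add_edge_le[OF simple]] k by linarith
  have "c \<noteq> x"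
  proof
    assume "c = x"
    with d4 assms(5) show False by simp
  qed
  show ?thesis
  proof (cases "c = y")
    case True
    have N: "{p, q, r, s} \<subseteq> insert x (nbrs G y)"
      using bowtieD(1)[OF b] True xy(3) by (auto simp: nbrs_add_edge)
    have x: "a \<notin> nbrs ?H x" if "a \<in> nbrs G y" for a
      using that no nbrs_subset[OF simple, of y] by (auto simp: nbrs_add_edge xy(3))
    have "p \<noteq> q" "r \<noteq> s" using b by (auto simp: bowtie_def)
    \<comment> \<open>Were \<open>x\<close> one of the four, its partner in the triangle would be
      adjacent to both \<open>x\<close> and \<open>y\<close>.\<close>
    then have "x \<notin> {p, q, r, s}"
      using N bowtieD(2-5)[OF b] x by blast
    then have "\<not> {x, y} \<subseteq> {c, p, q, r, s}"
      using True xy(3) by blast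
    then have "bowtie G c p q r s" by (rule bowtie_del_edge[OF b])
    then show ?thesis using True by blast
  next
    case False
    with \<open>c \<noteq> x\<close> have N: "nbrs ?H c = nbrs G c" by (simp add: nbrs_add_edge)
    have "\<not> (x \<in> nbrs G c \<and> y \<in> nbrs G c)" using no nbrs_sym[of c] by blast
    then have "\<not> {x, y} \<subseteq> {c, p, q, r, s}"
      using bowtieD(1)[OF b] N \<open>c \<noteq> x\<close> False by blast
    then have "bowtie G c p q r s" by (rule bowtie_del_edge[OF b])
    then show ?thesis using no_bowtie[of c p q r s] d N by simp
  qed
qed


text \<open>Two disjoint edges avoiding \<open>z\<close> would form a bowtie at \<open>z\<close>, so
  these edges form a star or a triangle. In the star case the centre \<open>w\<close> is universal
  too, and two universal vertices force many edges. The bound is doubled to be compared with the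
  degree sum.\<close>

lemma universal_vertex:
  assumes z: "z \<in> verts G" "nbrs G z = verts G - {z}"
  shows "2 * card (edges G) \<ge> 2 * card (verts G) + 5 \<or>
    (\<exists>a b c. distinct [a, b, c] \<and> {e \<in> edges G. z \<notin> e} = {{a, b}, {b, c}, {a, c}})"
proof -
  let ?V = "verts G" and ?H = "{e \<in> edges G. z \<notin> e}"
  have z_edge: "{z, u} \<in> edges G" if "u \<in> ?V" "u \<noteq> z" for u
    using that z(2) unfolding nbrs_def by blast
  have degz: "degree G z = card ?V - 1" using z finV by simp
  have two: "card e = 2" if "e \<in> ?H" for e
    using that simple by (auto simp: simple_graph_def pairs_def)
  have meet: "e \<inter> f \<noteq> {}" if e: "e \<in> ?H" and f: "f \<in> ?H" for e f
  proof
    assume disj: "e \<inter> f = {}"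
    obtain p q where pq: "e = {p, q}" "p \<noteq> q" "p \<in> ?V" "q \<in> ?V"
      using edgeE[OF simple] e by blast
    obtain r s where rs: "f = {r, s}" "r \<noteq> s" "r \<in> ?V" "s \<in> ?V"
      using edgeE[OF simple] f by blast
    have "z \<noteq> p" "z \<noteq> q" "z \<noteq> r" "z \<noteq> s" using e f pq rs by auto
    moreover have "{p, q} \<in> edges G" "{r, s} \<in> edges G" using e f pq rs by auto
    moreover have "p \<noteq> r" "p \<noteq> s" "q \<noteq> r" "q \<noteq> s" using disj pq rs by auto
    ultimately have "bowtie G z p q r s"
      using pq rs z_edge unfolding bowtie_def by simp
    \<comment> \<open>With at least \<open>k + 5\<close> vertices, the universal \<open>z\<close>
      has degree at least \<open>k + 4\<close>.\<close>
    then show False using no_bowtie[of z p q r s] large degz by simp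
  qed
  have "(\<exists>w. \<forall>e\<in>?H. w \<in> e) \<or>
      (\<exists>a b c. distinct [a, b, c] \<and> ?H = {{a, b}, {b, c}, {a, c}})"
    by (rule pairwise_intersecting_pairs[OF two meet])
  then show ?thesis
  proof
    assume "\<exists>w. \<forall>e\<in>?H. w \<in> e"
    then obtain w where 1: "\<And>e. e \<in> ?H \<Longrightarrow> w \<in> e" by blast
    \<comment> \<open>If every edge contains \<open>z\<close>, any other vertex serves as the centre
      of the empty star.\<close>
    have "\<exists>w\<in>?V - {z}. \<forall>e\<in>?H. w \<in> e"
    proof (cases "?H = {}")
      case True
      have "?V - {z} \<noteq> {}"
      proof
        assume "?V - {z} = {}"
        then have "degree G z = 0" unfolding z(2) by (simp only: card.empty)
        then show False using degz large by simp
      qed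
      with True show ?thesis by blast
    next
      case False
      then obtain e where "e \<in> ?H" by blast
      then have "w \<in> e" "e \<subseteq> ?V" "z \<notin> e"
        using 1 simple by (auto simp: simple_graph_def pairs_def)
      then show ?thesis using 1 by blast
    qed
    then obtain w where w: "w \<in> ?V" "w \<noteq> z" and star: "\<And>e. e \<in> ?H \<Longrightarrow> w \<in> e" by blast
    \<comment> \<open>After adding a missing edge at \<open>w\<close>, the set \<open>{z, w}\<close>
      still covers all edges, so no bowtie could arise.\<close>
    have uw: "u \<in> nbrs G w" if u: "u \<in> ?V" "u \<noteq> w" for u
    proof (rule ccontr)
      assume "u \<notin> nbrs G w"
      then obtain c p q r s where "bowtie (add_edge G {w, u}) c p q r s"
        using nonedge_bowtie[OF w(1) u(1) u(2)[symmetric]] by metis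
      then show False
        by (rule bowtie_no_cover[of _ _ _ _ _ _ z w]) (use star in \<open>auto simp: edges_add_edge\<close>)
    qed
    then have "nbrs G w = ?V - {w}" using nbrs_subset[OF simple] by blast
    then have degw: "degree G w = card ?V - 1" using w finV by simp
    have "2 \<le> degree G v" if v: "v \<in> ?V" for v
    proof (cases "v = z \<or> v = w")
      case True
      then show ?thesis using degz degw large by auto
    next
      case False
      then have "{z, w} \<subseteq> nbrs G v" using uw z v nbrs_sym[of _ G v] by blast
      then have "card {z, w} \<le> degree G v" by (rule card_mono[OF finite_nbrs[OF simple]])
      then show ?thesis using w by simp
    qed
    \<comment> \<open>With n vertices, each of \<open>z\<close> and \<open>w\<close> has degree n -
      1 = 2 + (n - 3). The total 4n - 6 suffices because n is at least 6.\<close>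
    then have "2 * card ?V + (\<Sum>v\<in>{z, w}. card ?V - 3) \<le> (\<Sum>v\<in>?V. degree G v)"
      by (intro sum_ge_const_subset[OF finV]) (use z(1) w degz degw large in auto)
    then have "2 * card ?V + 2 * (card ?V - 3) \<le> 2 * card (edges G)"
      unfolding handshake[OF simple] using w(2) by simp
    then have "2 * card (edges G) \<ge> 2 * card ?V + 5" using large k by linarith
    then show ?thesis ..
  qed (rule disjI2)
qed

section \<open>Edge bound without a universal vertex, by minimum degree\<close>

context
  assumes no_universal: "\<And>z. z \<in> verts G \<Longrightarrow> nbrs G z \<noteq> verts G - {z}"
begin

text \<open>An isolated \<open>x\<close> shares no neighbour with any other vertex, so every other
  vertex centres a bowtie and has degree at least 4.\<close>

lemma isolated_vertex:
  assumes x: "x \<in> verts G" "nbrs G x = {}"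
  shows "2 * card (edges G) \<ge> 2 * card (verts G) + 5"
proof -
  let ?V = "verts G"
  have "4 \<le> degree G y" if y: "y \<in> ?V - {x}" for y
  proof -
    have "y \<in> ?V" "x \<noteq> y" using y by auto
    then obtain p q r s where "bowtie G y p q r s"
      using bowtie_if_no_common_nbr[of x y] x by (simp, blast)
    then show ?thesis by (rule bowtie_degree[OF simple])
  qed
  then have "0 * card ?V + (\<Sum>v\<in>?V - {x}. 4) \<le> (\<Sum>v\<in>?V. degree G v)"
    by (intro sum_ge_const_subset[OF finV]) auto
  then show ?thesis using handshake[OF simple] finV x large k by simp
qed

text \<open>A vertex other than \<open>z\<close> and not adjacent to \<open>z\<close> shares no
  neighbour with the leaf \<open>x\<close>, so it centres a bowtie. Such a \<open>y\<close> exists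
  as \<open>z\<close> is not universal. Under the weights of \<open>handshake_remove\<close> all
  vertices weigh at least 2, and the five vertices of the bowtie at \<open>y\<close> at least
  4.\<close>

lemma leaf:
  assumes x: "x \<in> verts G" "nbrs G x = {z}"
  shows "2 * card (edges G) \<ge> 2 * card (verts G) + 5"
proof -
  let ?V = "verts G" and ?f = "\<lambda>v. degree G v + (if v \<in> nbrs G z then 1 else 0)"
  have z: "z \<in> ?V" "z \<noteq> x" "x \<in> nbrs G z"
    using x nbrs_subset[OF simple, of x] nbrs_sym[of x G z] by auto
  have far: "\<exists>p q r s. bowtie G y p q r s" if y: "y \<in> ?V" "y \<noteq> z" "y \<notin> nbrs G z" for y
  proof -
    have "x \<noteq> y" "y \<notin> nbrs G x" "nbrs G x \<inter> nbrs G y = {}"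
      using y x(2) z(3) nbrs_sym[of y G z] by auto
    then show ?thesis
      by (intro bowtie_if_no_common_nbr[OF x(1) y(1)]) (simp_all add: x(2))
  qed
  have deg_far: "4 \<le> degree G y" if y: "y \<in> ?V" "y \<noteq> z" "y \<notin> nbrs G z" for y
    using far[OF y] bowtie_degree[OF simple] by blast
  have f2: "2 \<le> ?f v" if v: "v \<in> ?V - {z}" for v
  proof (cases "v \<in> nbrs G z")
    case True
    then have "nbrs G v \<noteq> {}" using nbrs_sym[of v G z] by blast
    then show ?thesis using True finite_nbrs[OF simple] by (simp add: Suc_le_eq card_gt_0_iff)
  next
    case False
    then show ?thesis using deg_far[of v] v by simp
  qed
  obtain y where y: "y \<in> ?V" "y \<noteq> z" "y \<notin> nbrs G z"
    using no_universal[OF z(1)] nbrs_subset[OF simple, of z] by blast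
  then obtain p q r s where b: "bowtie G y p q r s" using far by blast
  \<comment> \<open>Here \<open>v'\<close> is the third vertex of a triangle with \<open>y\<close>
    and \<open>v\<close>. If \<open>v\<close> is adjacent to \<open>z\<close>, its neighbours
    \<open>z\<close>, \<open>y\<close>, \<open>v'\<close> and the extra unit give 4.\<close>
  have f4: "4 \<le> ?f v" if v: "v \<in> nbrs G y" and v': "v' \<in> nbrs G v" "v' \<in> nbrs G y" for v v'
  proof -
    have ne: "v \<noteq> z" "v' \<noteq> z" "v' \<noteq> y" "v \<in> ?V"
      using v v' y nbrs_sym[of z G y] nbrs_subset[OF simple, of y] by auto
    show ?thesis
    proof (cases "v \<in> nbrs G z")
      case True
      then have "{z, y, v'} \<subseteq> nbrs G v"
        using v v' nbrs_sym[of _ G v] by blast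
      then have "card {z, y, v'} \<le> degree G v" by (rule card_mono[OF finite_nbrs[OF simple]])
      then show ?thesis using True ne y(2) by simp
    next
      case False
      then show ?thesis using deg_far[of v] ne by simp
    qed
  qed
  have T: "{y, p, q, r, s} \<subseteq> ?V - {z}"
    using y bowtieD(1)[OF b] nbrs_subset[OF simple, of y] nbrs_sym[of z G y] by blast
  \<comment> \<open>With n vertices this gives 2(n - 1) + 10 = 2n + 8.\<close>
  have "2 * card (?V - {z}) + (\<Sum>v\<in>{y, p, q, r, s}. 2) \<le> (\<Sum>v\<in>?V - {z}. ?f v)"
  proof (rule sum_ge_const_subset[OF _ T f2])
    fix v assume "v \<in> {y, p, q, r, s}"
    then consider "v = y" | v' where "v \<in> nbrs G y" "v' \<in> nbrs G v" "v' \<in> nbrs G y"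
      using bowtieD[OF b] by blast
    then show "2 + 2 \<le> ?f v"
    proof cases
      case 1
      then show ?thesis using deg_far[OF y] by simp
    next
      case 2
      then show ?thesis using f4[of v v'] by simp
    qed
  qed (use finV in auto)
  moreover have "card {y, p, q, r, s} = 5" using b by (simp add: bowtie_def)
  ultimately show ?thesis
    using handshake_remove[OF simple z(1)] finV z(1) large by simp
qed

text \<open>If the bound fails, \<open>u\<close> is the only vertex of degree at least 4. Then
  \<open>u\<close> is the sole candidate for a common neighbour of high degree, which makes it
  adjacent to everything but \<open>v\<close>. A vertex not adjacent to \<open>v\<close> would in
  turn require \<open>u\<close> to be adjacent to \<open>v\<close>.\<close>

lemma degree_two_vertex:
  assumes x: "x \<in> verts G" "nbrs G x = {u, v}" "u \<noteq> v" and u5: "degree G u \<ge> 5"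
    and min2: "\<And>y. y \<in> verts G \<Longrightarrow> degree G y \<ge> 2"
  shows "2 * card (edges G) \<ge> 2 * card (verts G) + 5"
proof (rule ccontr)
  assume less: "\<not> ?thesis"
  let ?V = "verts G"
  have uv: "u \<in> ?V" "v \<in> ?V" "x \<in> nbrs G u" "x \<noteq> u" "x \<noteq> v"
    using x nbrs_subset[OF simple, of x] nbrs_sym[of x G u] by auto
  have degx: "degree G x \<le> 3" using x by simp
  have low: "degree G y \<le> 3" if y: "y \<in> ?V" "y \<noteq> u" for y
  proof (rule ccontr)
    assume "\<not> ?thesis"
    \<comment> \<open>Over the minimum degree 2, \<open>u\<close> has excess 3 and \<open>y\<close>
      excess 2; together they are exactly the 5 in the bound.\<close>
    then have "2 * card ?V + (\<Sum>w\<in>{u, y}. if w = u then 3 else 2) \<le> (\<Sum>w\<in>?V. degree G w)"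
      by (intro sum_ge_const_subset[OF finV]) (use u5 y uv min2 in auto)
    then show False using less handshake[OF simple] y by simp
  qed
  have adj_u: "y \<in> nbrs G u" if y: "y \<in> ?V" "y \<notin> {u, v}" for y
  proof (cases "y = x")
    case False
    have "\<not> 4 \<le> degree G y" using low[of y] y by simp
    moreover have "y \<notin> nbrs G x" using y x by simp
    ultimately obtain c where c: "c \<in> nbrs G x" "c \<in> nbrs G y" "degree G c \<ge> 5"
      using common_nbr_or_degree[OF x(1) y(1)] False degx by blast
    have "c \<noteq> v" using low[OF uv(2)] x(3) c(3) by auto
    then have "c = u" using c(1) x(2) by simp
    then show ?thesis using c nbrs_sym by metis
  qed (use uv in simp)
  have v: "v \<notin> nbrs G u"
  proof
    assume "v \<in> nbrs G u"
    then have "nbrs G u = ?V - {u}" using adj_u nbrs_subset[OF simple, of u] by blast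
    then show False using no_universal uv(1) by blast
  qed
  \<comment> \<open>At least four vertices lie outside \<open>{u, v}\<close>, while \<open>v\<close>
    has degree at most 3.\<close>
  have "\<not> ?V - {u, v} \<subseteq> nbrs G v"
  proof
    assume "?V - {u, v} \<subseteq> nbrs G v"
    then have "card (?V - {u, v}) \<le> degree G v" by (rule card_mono[OF finite_nbrs[OF simple]])
    moreover have "card (?V - {u, v}) = card ?V - 2"
      using uv x(3) finV by (simp add: card_Diff_subset)
    ultimately show False using low[of v] uv x(3) large k by simp
  qed
  then obtain y where y: "y \<in> ?V" "y \<notin> {u, v}" "y \<notin> nbrs G v" by blast
  have "\<not> 4 \<le> degree G y" using low[of y] y by simp
  moreover have "degree G v \<le> 3" using low[of v] uv x(3) by simp
  moreover have "v \<noteq> y" using y by blast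
  ultimately obtain c where c: "c \<in> nbrs G v" "degree G c \<ge> 5"
    using common_nbr_or_degree[OF uv(2) y(1) _ y(3)] by blast
  then have "c \<in> ?V" using nbrs_subset[OF simple, of v] by blast
  then have "c = u" using low[of c] c(2) by linarith
  then show False using c v nbrs_sym by metis
qed

text \<open>Minimum degree 3 gives enough edges at once, and degrees 0 and 1 are settled. At a
  vertex \<open>x\<close> of degree 2, neither neighbour may have degree 5 or more, so every vertex
  outside \<open>{x, u, v}\<close> has degree at least 4.\<close>

lemma no_universal_vertex: "2 * card (edges G) \<ge> 2 * card (verts G) + 5"
proof (rule ccontr)
  assume less: "\<not> ?thesis"
  let ?V = "verts G"
  have min2: "2 \<le> degree G x" if x: "x \<in> ?V" for x
  proof (rule ccontr)
    assume "\<not> ?thesis"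
    then consider "degree G x = 0" | "degree G x = 1" by linarith
    then show False
    proof cases
      case 1
      then show False using isolated_vertex[OF x] less finite_nbrs[OF simple] by simp
    next
      case 2
      then show False using leaf[OF x] less by (metis card_1_singletonE)
    qed
  qed
  have "\<exists>x\<in>?V. degree G x = 2"
  proof (rule ccontr)
    assume no2: "\<not> ?thesis"
    have "3 \<le> degree G x" if "x \<in> ?V" for x
    proof -
      have "degree G x \<noteq> 2" using no2 that by blast
      then show ?thesis using min2[OF that] by linarith
    qed
    then have "(\<Sum>v\<in>?V. degree G v) \<ge> card ?V * 3"
      using sum_bounded_below[of ?V 3 "degree G"] by simp
    then show False using less handshake[OF simple] large k by simp
  qed
  then obtain x u v where x: "x \<in> ?V" "nbrs G x = {u, v}" "u \<noteq> v"
    by (auto simp: card_2_iff)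
  have "\<not> 5 \<le> degree G u"
    using degree_two_vertex[OF x _ min2] less by blast
  moreover have "\<not> 5 \<le> degree G v"
    using degree_two_vertex[of x v u, OF x(1) _ _ _ min2] x(2,3) less by (metis insert_commute)
  ultimately have low: "degree G c < 5" if "c \<in> nbrs G x" for c
    using that unfolding x(2) by auto
  have "4 \<le> degree G y" if y: "y \<in> ?V - {x, u, v}" for y
  proof -
    have "y \<in> ?V" "x \<noteq> y" "y \<notin> nbrs G x" "degree G x \<le> 3" using x y by auto
    then show ?thesis using common_nbr_or_degree[OF x(1)] low not_less by blast
  qed
  then have "2 * card ?V + (\<Sum>w\<in>?V - {x, u, v}. 2) \<le> (\<Sum>w\<in>?V. degree G w)"
    by (intro sum_ge_const_subset[OF finV]) (use min2 in auto)
  moreover have "card (?V - {x, u, v}) \<ge> card ?V - 3"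
    using diff_card_le_card_Diff[of "{x, u, v}" ?V] card_length[of "[x, u, v]"] by simp
  ultimately show False using less handshake[OF simple] large k by simp
qed

end

text \<open>Twice the number of edges is even, so the bound 2n + 5 rounds up to n + 3 edges, one
  more than the extremal graph has.\<close>

lemma dichotomy:
  "card (edges G) \<ge> card (verts G) + 3 \<or>
    (\<exists>z a b c. z \<in> verts G \<and> nbrs G z = verts G - {z} \<and> distinct [a, b, c] \<and>
       {e \<in> edges G. z \<notin> e} = {{a, b}, {b, c}, {a, c}})"
proof (cases "\<exists>z\<in>verts G. nbrs G z = verts G - {z}")
  case True
  then obtain z where z: "z \<in> verts G" "nbrs G z = verts G - {z}" by blast
  from universal_vertex[OF z] show ?thesis
  proof
    assume "2 * card (verts G) + 5 \<le> 2 * card (edges G)"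
    then show ?thesis by simp
  next
    assume "\<exists>a b c. distinct [a, b, c] \<and> {e \<in> edges G. z \<notin> e} = {{a, b}, {b, c}, {a, c}}"
    then obtain a b c where
      "distinct [a, b, c]" "{e \<in> edges G. z \<notin> e} = {{a, b}, {b, c}, {a, c}}" by (elim exE conjE)
    with z show ?thesis by (intro disjI2 exI[of _ z] exI[of _ a] exI[of _ b] exI[of _ c] conjI)
  qed
next
  case False
  then have "2 * card (edges G) \<ge> 2 * card (verts G) + 5"
    by (intro no_universal_vertex) simp
  then show ?thesis by simp
qed

end


section \<open>The extremal graph\<close>

text \<open>The subtraction is truncated, so there are \<open>n\<close> vertices only for
  \<open>n\<close> at least 4, as assumed below.\<close>

abbreviation K4_leaves :: "nat \<Rightarrow> nat graph" where
  "K4_leaves n \<equiv> complete_leaves 4 (n - 4)"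

lemma verts_K4_leaves: "n \<ge> 4 \<Longrightarrow> verts (K4_leaves n) = {..<n}"
  by (simp add: complete_leaves_def)

lemma edges_K4_leaves:
  "n \<ge> 4 \<Longrightarrow> edges (K4_leaves n) = pairs {..<4} \<union> (\<lambda>i. {0, i}) ` {4..<n}"
  by (auto simp: complete_leaves_def complete_def)

lemma K4_leaves_adj:
  assumes "n \<ge> 4"
  shows "{u, v} \<in> edges (K4_leaves n) \<longleftrightarrow>
    u \<noteq> v \<and> u < n \<and> v < n \<and> (u = 0 \<or> v = 0 \<or> (u < 4 \<and> v < 4))"
  using assms unfolding edges_K4_leaves[OF assms]
  by (auto simp: pair_mem_pairs doubleton_eq_iff image_iff)

lemma simple_K4_leaves:
  assumes "n \<ge> 4"
  shows "simple_graph (K4_leaves n)"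
proof -
  have "pairs {..<4} \<subseteq> pairs {..<n}" using assms by (auto simp: pairs_def)
  moreover have "{0, i} \<in> pairs {..<n}" if "i \<in> {4..<n}" for i
    using that by (simp add: pair_mem_pairs)
  ultimately show ?thesis
    unfolding simple_graph_def edges_K4_leaves[OF assms] verts_K4_leaves[OF assms] by auto
qed

lemma card_edges_K4_leaves:
  assumes "n \<ge> 4"
  shows "card (edges (K4_leaves n)) = n + 2"
proof -
  have "card (pairs {..<4::nat}) = 6"
    using n_subsets[of "{..<4::nat}" 2] by (simp add: pairs_def choose_two)
  moreover have "card ((\<lambda>i. {0, i}) ` {4..<n}) = n - 4"
    by (subst card_image) (auto simp: inj_on_def doubleton_eq_iff)
  moreover have "pairs {..<4} \<inter> (\<lambda>i. {0, i}) ` {4..<n} = {}"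
    by (auto simp: pairs_def)
  moreover have "finite (pairs {..<4::nat})"
    by (rule finite_subset[of _ "Pow {..<4}"]) (auto simp: pairs_def)
  ultimately show ?thesis
    using assms by (simp add: edges_K4_leaves card_Un_disjoint)
qed

text \<open>All triangles lie inside the \<open>K4\<close>, which has too few vertices: a bowtie
  centred at 0 would place four vertices in \<open>{1..<4}\<close>, any other one five vertices in
  \<open>{..<4}\<close>.\<close>

lemma K4_leaves_no_bowtie:
  assumes "n \<ge> 4"
  shows "\<not> bowtie (K4_leaves n) c p q r s"
proof
  assume b: "bowtie (K4_leaves n) c p q r s"
  then have adj: "c = 0 \<or> p = 0 \<or> (c < 4 \<and> p < 4)" "c = 0 \<or> q = 0 \<or> (c < 4 \<and> q < 4)"
    "c = 0 \<or> r = 0 \<or> (c < 4 \<and> r < 4)" "c = 0 \<or> s = 0 \<or> (c < 4 \<and> s < 4)"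
    "p = 0 \<or> q = 0 \<or> (p < 4 \<and> q < 4)" "r = 0 \<or> s = 0 \<or> (r < 4 \<and> s < 4)"
    by (simp_all add: bowtie_def K4_leaves_adj[OF assms])
  have d: "distinct [c, p, q, r, s]" using b by (simp add: bowtie_def)
  show False
  proof (cases "c = 0")
    case True
    with d adj have "{p, q, r, s} \<subseteq> {1..<4}" by auto
    then have "card {p, q, r, s} \<le> card {1..<4::nat}" by (rule card_mono[rotated]) simp
    then show False using d by simp
  next
    case False
    with d adj have "{c, p, q, r, s} \<subseteq> {..<4}" by auto
    then have "card {c, p, q, r, s} \<le> card {..<4::nat}" by (rule card_mono[rotated]) simp
    then show False using d by simp
  qed
qed

text \<open>The larger end \<open>v\<close> of a missing edge is a leaf, so 0, \<open>u\<close>,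
  \<open>v\<close> become a triangle. Two vertices among 1, 2, 3 differ from \<open>u\<close> and
  form the second triangle at 0.\<close>

lemma K4_leaves_add_edge_bowtie:
  assumes "n \<ge> 4" "u < v" "v < n" "{u, v} \<notin> edges (K4_leaves n)"
  shows "\<exists>r s. bowtie (add_edge (K4_leaves n) {u, v}) 0 u v r s"
proof -
  have uv: "u \<noteq> 0" "v \<ge> 4" using assms K4_leaves_adj[OF assms(1), of u v] by auto
  obtain r s where "r \<noteq> s" "r \<in> {1..<4}" "s \<in> {1..<4}" "r \<noteq> u" "s \<noteq> u"
  proof (cases "u = 1")
    case True
    then show ?thesis using that[of 2 3] by simp
  next
    case False
    then show ?thesis using that[of 1 2] that[of 1 3] by (cases "u = 2") auto
  qed
  then have "bowtie (add_edge (K4_leaves n) {u, v}) 0 u v r s"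
    using assms uv by (auto simp: bowtie_def edges_add_edge K4_leaves_adj)
  then show ?thesis by blast
qed

lemma saturated_K4_leaves:
  assumes n: "n \<ge> k + 5"
  shows "saturated (windmill k) (K4_leaves n)"
  unfolding saturated_def
proof (intro conjI ballI)
  let ?K = "K4_leaves n"
  have n4: "n \<ge> 4" using n by simp
  show simple: "simple_graph ?K" by (rule simple_K4_leaves[OF n4])
  show "\<not> contains_copy ?K (windmill k)"
    using K4_leaves_no_bowtie[OF n4] by (simp add: contains_windmill_iff[OF simple])
  fix e assume "e \<in> edges (complement ?K)"
  then have e: "e \<in> pairs {..<n}" "e \<notin> edges ?K"
    by (simp_all add: complement_def verts_K4_leaves[OF n4])
  then obtain u v where uv: "e = {u, v}" "u < v" "v < n"
    by (auto simp: pairs_def card_2_iff) (metis insert_commute linorder_neqE_nat)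
  have simple': "simple_graph (add_edge ?K e)"
    unfolding uv(1) using uv by (intro simple_add_edge simple) (simp_all add: verts_K4_leaves[OF n4])
  \<comment> \<open>The centre 0 has degree at least \<open>n - 1\<close>, hence at least
    \<open>k + 4\<close>: only the bowtie was lacking.\<close>
  have "{1..<n} \<subseteq> nbrs ?K 0"
    using K4_leaves_adj[OF n4] by (auto simp: mem_nbrs)
  then have "{1..<n} \<subseteq> nbrs (add_edge ?K e) 0"
    unfolding uv(1) nbrs_add_edge by blast
  then have "card {1..<n} \<le> degree (add_edge ?K e) 0"
    by (rule card_mono[OF finite_nbrs[OF simple']])
  then have "k + 4 \<le> degree (add_edge ?K e) 0" using n by simp
  moreover obtain r s where "bowtie (add_edge ?K e) 0 u v r s"
    using K4_leaves_add_edge_bowtie[OF n4 uv(2,3)] e(2) uv(1) by blast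
  ultimately show "contains_copy (add_edge ?K e) (windmill k)"
    unfolding contains_windmill_iff[OF simple'] by blast
qed

text \<open>All edges at \<open>z\<close> and the triangle avoiding it determine the graph: send 0
  to \<open>z\<close>, the vertices 1, 2, 3 to the triangle, and the leaves to the remaining
  vertices in any order.\<close>

lemma isomorphic_K4_leaves:
  fixes G :: "'a graph"
  assumes G: "simple_graph G" and z: "z \<in> verts G" "nbrs G z = verts G - {z}"
    and d: "distinct [a, b, c]"
    and H: "{e \<in> edges G. z \<notin> e} = {{a, b}, {b, c}, {a, c}}"
  shows "isomorphic (K4_leaves (card (verts G))) G"
proof -
  let ?V = "verts G" and ?n = "card (verts G)"
  have fin: "finite ?V" using G by (simp add: simple_graph_def)
  have "{a, b} \<in> {e \<in> edges G. z \<notin> e}" "{b, c} \<in> {e \<in> edges G. z \<notin> e}"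
    unfolding H by simp_all
  then have abc: "{a, b} \<in> edges G" "{b, c} \<in> edges G" "z \<notin> {a, b, c}" by simp_all
  have V: "{z, a, b, c} \<subseteq> ?V" using z edge_pairD[OF G abc(1)] edge_pairD[OF G abc(2)] by blast
  have card4: "card {z, a, b, c} = 4" using abc(3) d by simp
  have n4: "?n \<ge> 4" using card_mono[OF fin V] card4 by simp
  have "card {4..<?n} = card (?V - {z, a, b, c})"
    using card4 V fin by (simp add: card_Diff_subset)
  then obtain g where g: "bij_betw g {4..<?n} (?V - {z, a, b, c})"
    using finite_same_card_bij[of "{4..<?n}" "?V - {z, a, b, c}"] fin by auto
  \<comment> \<open>The default value \<open>c\<close> is the image of 3; larger indices are handled
    by \<open>g\<close>.\<close>
  define h where "h i = (if i = (0::nat) then z else if i = 1 then a else if i = 2 then b else c)" for i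
  define f where "f i = (if i < 4 then h i else g i)" for i
  have lt4: "{..<4::nat} = {0, 1, 2, 3}" by auto
  have h: "bij_betw h {..<4} {z, a, b, c}"
    unfolding bij_betw_def lt4 using abc(3) d by (auto simp: h_def)
  have "bij_betw f ({..<4} \<union> {4..<?n}) ({z, a, b, c} \<union> (?V - {z, a, b, c}))"
  proof (rule bij_betw_combine)
    show "bij_betw f {..<4} {z, a, b, c}"
      using h by (rule bij_betw_cong[THEN iffD1, rotated]) (simp add: f_def)
    show "bij_betw f {4..<?n} (?V - {z, a, b, c})"
      using g by (rule bij_betw_cong[THEN iffD1, rotated]) (simp add: f_def)
  qed blast
  moreover have "{..<4} \<union> {4..<?n} = {..<?n}" using n4 by auto
  moreover have "{z, a, b, c} \<union> (?V - {z, a, b, c}) = ?V" using V by blast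
  ultimately have f: "bij_betw f {..<?n} ?V" by simp
  have inj: "f u = f v \<longleftrightarrow> u = v" if "u < ?n" "v < ?n" for u v
    using f that by (auto simp: bij_betw_def inj_on_def)
  have f0: "f 0 = z" "f 1 = a" "f 2 = b" "f 3 = c" by (simp_all add: f_def h_def)
  have fV: "f u \<in> ?V" if "u < ?n" for u
    using f that by (auto simp: bij_betw_def)
  have adj_z: "{z, f v} \<in> edges G \<longleftrightarrow> v \<noteq> 0" if "v < ?n" for v
  proof -
    have "{z, f v} \<in> edges G \<longleftrightarrow> f v \<noteq> z"
      using z(2) fV[OF that] unfolding mem_nbrs[symmetric] by simp
    also have "\<dots> \<longleftrightarrow> v \<noteq> 0"
      using inj[of v 0] that n4 f0(1) by simp
    finally show ?thesis .
  qed
  have adj: "{f u, f v} \<in> edges G \<longleftrightarrow> u \<noteq> v \<and> u < 4 \<and> v < 4"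
    if uv: "u < ?n" "v < ?n" "u \<noteq> 0" "v \<noteq> 0" for u v
  proof -
    have "f u \<noteq> z" "f v \<noteq> z"
      using inj[of u 0] inj[of v 0] uv n4 f0(1) by simp_all
    then have "{f u, f v} \<in> edges G \<longleftrightarrow> {f u, f v} \<in> {e \<in> edges G. z \<notin> e}" by simp
    also have "\<dots> \<longleftrightarrow> {f u, f v} \<in> {{f 1, f 2}, {f 2, f 3}, {f 1, f 3}}"
      unfolding H f0 ..
    also have "\<dots> \<longleftrightarrow> (u = 1 \<and> v = 2) \<or> (u = 2 \<and> v = 1) \<or> (u = 2 \<and> v = 3) \<or> (u = 3 \<and> v = 2)
        \<or> (u = 1 \<and> v = 3) \<or> (u = 3 \<and> v = 1)"
      using n4 uv(1,2) by (simp add: doubleton_eq_iff inj)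
    also have "\<dots> \<longleftrightarrow> u \<noteq> v \<and> u < 4 \<and> v < 4"
      using uv(3,4) by auto
    finally show ?thesis .
  qed
  show ?thesis
  proof (rule isomorphicI[OF simple_K4_leaves[OF n4] G])
    show "bij_betw f (verts (K4_leaves ?n)) ?V" using f by (simp add: verts_K4_leaves[OF n4])
    fix u v assume "u \<in> verts (K4_leaves ?n)" "v \<in> verts (K4_leaves ?n)"
    then have uv: "u < ?n" "v < ?n" by (simp_all add: verts_K4_leaves[OF n4])
    consider "u = 0" | "v = 0" | "u \<noteq> 0" "v \<noteq> 0" by blast
    then show "{f u, f v} \<in> edges G \<longleftrightarrow> {u, v} \<in> edges (K4_leaves ?n)"
    proof cases
      case 1
      then show ?thesis using adj_z[OF uv(2)] uv f0(1) by (auto simp: K4_leaves_adj[OF n4])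
    next
      case 2
      then show ?thesis using adj_z[OF uv(1)] uv f0(1)
        by (auto simp: K4_leaves_adj[OF n4] insert_commute)
    next
      case 3
      then show ?thesis using adj[OF uv 3] uv by (auto simp: K4_leaves_adj[OF n4])
    qed
  qed
qed

section \<open>The saturation number and uniqueness of the extremal graph\<close>

lemma isomorphic_card_edges:
  assumes "simple_graph G" "isomorphic G H"
  shows "card (edges H) = card (edges G)"
proof -
  obtain f where f: "bij_betw f (verts G) (verts H)" "edges H = (\<lambda>e. f ` e) ` edges G"
    using assms(2) by (auto simp: isomorphic_def)
  have "edges G \<subseteq> Pow (verts G)" using assms(1) by (auto simp: simple_graph_def pairs_def)
  then have "inj_on (\<lambda>e. f ` e) (edges G)"
    by (rule inj_on_subset[OF inj_on_image_Pow[OF bij_betw_imp_inj_on[OF f(1)]]])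
  then show ?thesis using f(2) by (simp add: card_image)
qed

lemma saturated_windmill_edges:
  assumes "saturated (windmill k) G" "k \<ge> 1" "card (verts G) \<ge> k + 5"
  shows "card (edges G) \<ge> card (verts G) + 3 \<or> isomorphic (K4_leaves (card (verts G))) G"
proof -
  interpret windmill_saturated G k using assms by unfold_locales
  from dichotomy show ?thesis
    by (elim disjE exE conjE) (blast, rule disjI2, rule isomorphic_K4_leaves[OF simple])
qed

theorem theorem1p4:
  fixes q n :: nat
  assumes "q \<ge> 1" and "n \<ge> q + 5"
  shows "sat n (join (complete 1) (disj_union (copies 2 (complete 2)) (copies q (complete 1)))) = n + 2 \<and>
         SAT n (join (complete 1) (disj_union (copies 2 (complete 2)) (copies q (complete 1)))) =
           {iso_class (complete_leaves 4 (n - 4))}"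
proof -
  let ?S = "saturated_graphs n (windmill q)"
  have n4: "n \<ge> 4" using assms by simp
  note simple = simple_K4_leaves[OF n4] and edges = card_edges_K4_leaves[OF n4]
  have K: "K4_leaves n \<in> ?S"
    using saturated_K4_leaves[OF assms(2)] by (simp add: saturated_graphs_def verts_K4_leaves[OF n4])
  have dich: "card (edges G) \<ge> n + 3 \<or> isomorphic (K4_leaves n) G" if "G \<in> ?S" for G
    using that saturated_windmill_edges[of q G] assms by (auto simp: saturated_graphs_def)
  have sat: "sat n (windmill q) = n + 2"
    unfolding sat_def
  proof (rule Least_equality)
    show "\<exists>G\<in>?S. card (edges G) = n + 2" using K edges by blast
    fix m assume "\<exists>G\<in>?S. card (edges G) = m"
    \<comment> \<open>A saturated graph has at least \<open>n + 3\<close> edges or, being isomorphic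
      to \<open>K4_leaves n\<close>, exactly \<open>n + 2\<close>.\<close>
    then show "n + 2 \<le> m" using dich isomorphic_card_edges[OF simple] edges by fastforce
  qed
  have "iso_class G = iso_class (K4_leaves n)" if G: "G \<in> ?S" "card (edges G) = n + 2" for G
  proof -
    have "isomorphic (K4_leaves n) G" using dich[OF G(1)] G(2) by simp
    moreover have "simple_graph G" using G(1) by (simp add: saturated_graphs_def saturated_def)
    ultimately show ?thesis using iso_class_eq[OF simple] by blast
  qed
  then have "SAT n (windmill q) = {iso_class (K4_leaves n)}"
    \<comment> \<open>Membership of \<open>K4_leaves n\<close> shows that the set of classes is
      nonempty, so it is this singleton.\<close>
    unfolding SAT_def sat using K edges by blast
  with sat show ?thesis by (simp add: windmill_def)
qed

end
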